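(* For every $n\in\mathbb N$, $B^{2^{n+1}}_\infty\not\leq\omega^{(n)}$.
   Context: A ceer is an equivalence relation on $\mathbb N$ c.e. as a subset of $\mathbb N^2$; $R_1\leq R_2$ means there is a total computable $f$ with $xR_1y\Leftrightarrow f(x)R_2f(y)$. Let $\varphi_e$ be the standard enumeration of partial computable functions, $W_e$ the c.e. sets, $\langle\cdot,\cdot\rangle$ a computable pairing bijection. A ceer is $k$-bounded ($k>0$) if each class has at most $k$ elements. For $k>1$, $B^k_e$ is obtained from the enumeration of the equivalence relation generated by $\{(x,y):\langle x,y\rangle\in W_e\}$ by omitting any enumerated pair that would create a class of size $>k$; $\{B^k_e\}$ enumerates exactly the $k$-bounded ceers, and $B^k_\infty$ is defined by $\langle x,z\rangle B^k_\infty\langle y,z\rangle\Leftrightarrow xB^k_zy$ (no other distinct pairs related); $B^k_\infty$ is $k$-bounded and every $k$-bounded ceer reduces to it. With $\omega$ the identity relation on $\mathbb N$, the halting jump of a ceer $E$ is $xE'y\Leftrightarrow x=y\lor(\varphi_x(x)\!\downarrow,\varphi_y(y)\!\downarrow,\ \varphi_x(x)E\varphi_y(y))$, and $\omega^{(0)}=\omega$, $\omega^{(n+1)}=(\omega^{(n)})'$. *)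

theory Defs
  imports Main "HOL-Library.Nat_Bijection"
begin

section \<open>Partial computable functions\<close>

text \<open>
  Programs for the unary partial recursive functions. The pairing
  \<^const>\<open>prod_encode\<close> replaces argument tuples, so that unary functions suffice.
\<close>

datatype recf =
    rZero | rSucc | rFst | rSnd
  | rPair recf recf
  | rComp recf recf
  | rPrec recf recf
  | rMu recf

text \<open>
  \<open>eval_in Z p x\<close> runs \<open>p\<close> on \<open>x\<close>, where every unbounded search only looks for witnesses
  in \<open>Z\<close>; \<^const>\<open>None\<close> means divergence. For \<open>Z = UNIV\<close> this is the true semantics, while
  for \<open>Z = {..<s}\<close> it is a computable approximation to it: all evaluations terminate,
  convergence persists when \<open>s\<close> increases, and every convergent computation converges for
  all large \<open>s\<close>.
\<close>

primrec eval_in :: "nat set \<Rightarrow> recf \<Rightarrow> nat \<Rightarrow> nat option" where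
  "eval_in Z rZero x = Some 0"
| "eval_in Z rSucc x = Some (Suc x)"
| "eval_in Z rFst x = Some (fst (prod_decode x))"
| "eval_in Z rSnd x = Some (snd (prod_decode x))"
| "eval_in Z (rPair p q) x =
     Option.bind (eval_in Z p x) (\<lambda>a. Option.bind (eval_in Z q x) (\<lambda>b. Some (prod_encode (a, b))))"
| "eval_in Z (rComp p q) x = Option.bind (eval_in Z q x) (eval_in Z p)"
| "eval_in Z (rPrec p q) x =
     (case prod_decode x of (a, m) \<Rightarrow>
        rec_nat (eval_in Z p a)
          (\<lambda>i r. Option.bind r (\<lambda>v. eval_in Z q (prod_encode (a, prod_encode (i, v))))) m)"
| "eval_in Z (rMu p) x =
     (let hit = (\<lambda>z. eval_in Z p (prod_encode (x, z)) = Some 0 \<and>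
                     (\<forall>y<z. \<exists>v. eval_in Z p (prod_encode (x, y)) = Some (Suc v)))
      in if \<exists>z\<in>Z. hit z then Some (THE z. hit z) else None)"

primrec gnum :: "recf \<Rightarrow> nat" where
  "gnum rZero = 0"
| "gnum rSucc = 1"
| "gnum rFst = 2"
| "gnum rSnd = 3"
| "gnum (rPair p q) = 4 + 4 * prod_encode (gnum p, gnum q)"
| "gnum (rComp p q) = 5 + 4 * prod_encode (gnum p, gnum q)"
| "gnum (rPrec p q) = 6 + 4 * prod_encode (gnum p, gnum q)"
| "gnum (rMu p) = 7 + 4 * gnum p"

lemma inj_gnum: "inj gnum"
proof (rule injI)
  have ne: "4 * a \<noteq> Suc (4 * b)" "4 * a \<noteq> Suc (Suc (4 * b))" "4 * a \<noteq> 3 + 4 * b" for a b :: nat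
    by presburger+
  show "gnum p = gnum q \<Longrightarrow> p = q" for p q
  proof (induction p arbitrary: q)
    case (rPair p1 p2) then show ?case by (cases q) (simp_all add: ne ne[symmetric])
  next
    case (rComp p1 p2) then show ?case by (cases q) (simp_all add: ne ne[symmetric])
  next
    case (rPrec p1 p2) then show ?case by (cases q) (simp_all add: ne ne[symmetric])
  next
    case (rMu p) then show ?case by (cases q) (simp_all add: ne ne[symmetric])
  qed (case_tac q; simp)+
qed

lemma surj_gnum: "surj gnum"
proof -
  have "\<exists>p. gnum p = n" for n
  proof (induction n rule: less_induct)
    case (less n)
    show ?case
    proof (cases "n < 4")
      case True
      then consider "n = 0" | "n = 1" | "n = 2" | "n = 3" by linarith
      then show ?thesis
        by cases (use gnum.simps(1-4) in blast)+
    next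
      case False
      define m where "m = (n - 4) div 4"
      define i where "i = (n - 4) mod 4"
      obtain a b where ab: "m = prod_encode (a, b)" by (metis prod_decode_inverse surj_pair)
      have n: "n = 4 + i + 4 * m" and i: "i < 4" using False by (auto simp: m_def i_def)
      have "a < n" "b < n" "m < n"
        using n ab le_prod_encode_1[of a b] le_prod_encode_2[of b a] by linarith+
      then obtain p q r where pqr: "gnum p = a" "gnum q = b" "gnum r = m" using less by metis
      from i consider "i = 0" | "i = 1" | "i = 2" | "i = 3" by linarith
      then show ?thesis
      proof cases
        case 1 with n ab pqr have "gnum (rPair p q) = n" by simp then show ?thesis ..
      next
        case 2 with n ab pqr have "gnum (rComp p q) = n" by simp then show ?thesis ..
      next
        case 3 with n ab pqr have "gnum (rPrec p q) = n" by simp then show ?thesis ..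
      next
        case 4 with n ab pqr have "gnum (rMu r) = n" by simp then show ?thesis ..
      qed
    qed
  qed
  then show ?thesis by (metis surjI)
qed

lemma bij_gnum: "bij gnum"
  using inj_gnum surj_gnum by (rule bijI)

definition phi :: "nat \<Rightarrow> nat \<Rightarrow> nat option" where
  "phi e = eval_in UNIV (inv gnum e)"

definition W :: "nat \<Rightarrow> nat set" where
  "W e = {x. phi e x \<noteq> None}"

definition W_stage :: "nat \<Rightarrow> nat \<Rightarrow> nat set" where
  "W_stage e s = {x. x < s \<and> eval_in {..<s} (inv gnum e) x \<noteq> None}"

definition total_computable :: "(nat \<Rightarrow> nat) \<Rightarrow> bool" where
  "total_computable f \<longleftrightarrow> (\<exists>e. \<forall>x. phi e x = Some (f x))"

lemma hit_unique:
  fixes g :: "nat \<Rightarrow> nat option"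
  assumes "g z = Some 0" "\<forall>y<z. \<exists>v. g y = Some (Suc v)"
    and "g z' = Some 0" "\<forall>y<z'. \<exists>v. g y = Some (Suc v)"
  shows "z' = z"
  using assms by (metis Zero_not_Suc linorder_neqE_nat option.inject)

lemma eval_in_Mu_iff:
  "eval_in Z (rMu p) x = Some z \<longleftrightarrow>
     z \<in> Z \<and> eval_in Z p (prod_encode (x, z)) = Some 0 \<and>
     (\<forall>y<z. \<exists>v. eval_in Z p (prod_encode (x, y)) = Some (Suc v))"
proof -
  define hit where "hit = (\<lambda>z. eval_in Z p (prod_encode (x, z)) = Some 0 \<and>
                     (\<forall>y<z. \<exists>v. eval_in Z p (prod_encode (x, y)) = Some (Suc v)))"
  have u: "hit z \<Longrightarrow> hit z' \<Longrightarrow> z' = z" for z z'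
    unfolding hit_def by (rule hit_unique[of "\<lambda>y. eval_in Z p (prod_encode (x, y))"]) auto
  have the: "hit z \<Longrightarrow> (THE z. hit z) = z" for z
    using u by (intro the_equality) auto
  have e: "eval_in Z (rMu p) x = (if \<exists>z\<in>Z. hit z then Some (THE z. hit z) else None)"
    by (simp only: eval_in.simps hit_def Let_def)
  have "eval_in Z (rMu p) x = Some z \<longleftrightarrow> z \<in> Z \<and> hit z"
    unfolding e using the by auto
  then show ?thesis by (simp add: hit_def)
qed

lemma eval_in_mono:
  assumes "Z \<subseteq> Z'"
  shows "eval_in Z p x = Some y \<Longrightarrow> eval_in Z' p x = Some y"
proof (induction p arbitrary: x y)
  case (rPair p q)
  then show ?case by (auto simp: Option.bind_eq_Some_conv)
next
  case (rComp p q)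
  then show ?case by (auto simp: Option.bind_eq_Some_conv)
next
  case (rPrec p q)
  obtain a m where am: "prod_decode x = (a, m)" by (cases "prod_decode x")
  have "rec_nat (eval_in Z p a)
          (\<lambda>i r. Option.bind r (\<lambda>v. eval_in Z q (prod_encode (a, prod_encode (i, v))))) m = Some y
     \<Longrightarrow> rec_nat (eval_in Z' p a)
          (\<lambda>i r. Option.bind r (\<lambda>v. eval_in Z' q (prod_encode (a, prod_encode (i, v))))) m = Some y"
    for y
    by (induction m arbitrary: y) (auto simp: Option.bind_eq_Some_conv rPrec.IH)
  with rPrec.prems am show ?case by simp
next
  case (rMu p)
  then show ?case using assms unfolding eval_in_Mu_iff by blast
qed auto

lemma eval_in_limit:
  "eval_in UNIV p x = Some y \<Longrightarrow> \<exists>s. eval_in {..<s} p x = Some y"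
proof (induction p arbitrary: x y)
  case (rPair p q)
  then obtain a b s t where "eval_in {..<s} p x = Some a" "eval_in {..<t} q x = Some b"
      "y = prod_encode (a, b)"
    by (fastforce simp: Option.bind_eq_Some_conv)
  then have "eval_in {..<max s t} (rPair p q) x = Some y"
    using eval_in_mono[of "{..<s}" "{..<max s t}"] eval_in_mono[of "{..<t}" "{..<max s t}"] by simp
  then show ?case ..
next
  case (rComp p q)
  then obtain a s t where "eval_in {..<s} q x = Some a" "eval_in {..<t} p a = Some y"
    by (fastforce simp: Option.bind_eq_Some_conv)
  then have "eval_in {..<max s t} (rComp p q) x = Some y"
    using eval_in_mono[of "{..<s}" "{..<max s t}"] eval_in_mono[of "{..<t}" "{..<max s t}"] by simp
  then show ?case ..
next
  case (rPrec p q)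
  obtain a m where am: "prod_decode x = (a, m)" by (cases "prod_decode x")
  define R where "R Z m = rec_nat (eval_in Z p a)
      (\<lambda>i r. Option.bind r (\<lambda>v. eval_in Z q (prod_encode (a, prod_encode (i, v))))) m" for Z m
  have R: "eval_in Z (rPrec p q) (prod_encode (a, m)) = R Z m" for Z m by (simp add: R_def)
  have "R UNIV m = Some y \<Longrightarrow> \<exists>s. R {..<s} m = Some y" for y
  proof (induction m arbitrary: y)
    case 0
    then show ?case using rPrec.IH(1) by (simp add: R_def)
  next
    case (Suc m)
    from Suc.prems obtain v where v: "R UNIV m = Some v"
        "eval_in UNIV q (prod_encode (a, prod_encode (m, v))) = Some y"
      by (auto simp: R_def Option.bind_eq_Some_conv)
    obtain s where s: "R {..<s} m = Some v" using Suc.IH v(1) by blast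
    obtain t where t: "eval_in {..<t} q (prod_encode (a, prod_encode (m, v))) = Some y"
      using rPrec.IH(2) v(2) by blast
    have "R {..<max s t} m = Some v"
      using s eval_in_mono[of "{..<s}" "{..<max s t}" "rPrec p q"] unfolding R[symmetric] by fastforce
    moreover have "eval_in {..<max s t} q (prod_encode (a, prod_encode (m, v))) = Some y"
      using t eval_in_mono[of "{..<t}" "{..<max s t}"] by simp
    ultimately have "R {..<max s t} (Suc m) = Some y" by (simp add: R_def)
    then show ?case ..
  qed
  with rPrec.prems am show ?case by (simp add: R_def)
next
  case (rMu p)
  let ?e = "\<lambda>Z z. eval_in Z p (prod_encode (x, z))"
  from rMu.prems have y: "?e UNIV y = Some 0" "\<forall>z<y. \<exists>v. ?e UNIV z = Some (Suc v)"
    unfolding eval_in_Mu_iff by auto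
  have "\<forall>z\<le>y. \<exists>s v. ?e UNIV z = Some v \<and> ?e {..<s} z = Some v"
    using rMu.IH y by (metis le_neq_implies_less)
  then obtain s where s: "\<And>z. z \<le> y \<Longrightarrow> \<exists>v. ?e UNIV z = Some v \<and> ?e {..<s z} z = Some v"
    by metis
  define t where "t = Max (insert (Suc y) (s ` {..y}))"
  have st: "s z \<le> t" if "z \<le> y" for z unfolding t_def using that by (intro Max_ge) auto
  have yt: "y < t" by (simp add: t_def Max_gr_iff)
  have "?e {..<t} z = ?e UNIV z" if "z \<le> y" for z
    using s[OF that] eval_in_mono[of "{..<s z}" "{..<t}"] st[OF that] by fastforce
  then have "eval_in {..<t} (rMu p) x = Some y"
    unfolding eval_in_Mu_iff using y yt by auto
  then show ?case ..
qed auto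

lemma W_eq_Union_W_stage: "W e = (\<Union>s. W_stage e s)"
proof (intro set_eqI iffI)
  fix x assume "x \<in> W e"
  then obtain y s where "eval_in {..<s} (inv gnum e) x = Some y"
    using eval_in_limit unfolding W_def phi_def by blast
  then have "eval_in {..<max s (Suc x)} (inv gnum e) x = Some y"
    using eval_in_mono[of "{..<s}" "{..<max s (Suc x)}"] by simp
  then have "x \<in> W_stage e (max s (Suc x))" by (simp add: W_stage_def)
  then show "x \<in> (\<Union>s. W_stage e s)" by blast
next
  fix x assume "x \<in> (\<Union>s. W_stage e s)"
  then show "x \<in> W e"
    using eval_in_mono[OF subset_UNIV] unfolding W_stage_def W_def phi_def by fastforce
qed

lemma W_stage_mono:
  assumes "s \<le> t" shows "W_stage e s \<subseteq> W_stage e t"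
  using assms eval_in_mono[of "{..<s}" "{..<t}"] unfolding W_stage_def by fastforce

section \<open>Ceers and reducibility\<close>

definition ceer :: "(nat \<Rightarrow> nat \<Rightarrow> bool) \<Rightarrow> bool" where
  "ceer E \<longleftrightarrow> equivp E \<and> (\<exists>e. W e = {prod_encode (x, y) |x y. E x y})"

definition reducible :: "(nat \<Rightarrow> nat \<Rightarrow> bool) \<Rightarrow> (nat \<Rightarrow> nat \<Rightarrow> bool) \<Rightarrow> bool"  (infix "\<le>\<^sub>c" 50) where
  "R \<le>\<^sub>c S \<longleftrightarrow> (\<exists>f. total_computable f \<and> (\<forall>x y. R x y \<longleftrightarrow> S (f x) (f y)))"

definition k_bounded :: "nat \<Rightarrow> (nat \<Rightarrow> nat \<Rightarrow> bool) \<Rightarrow> bool" where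
  "k_bounded k E \<longleftrightarrow> (\<forall>x. finite {y. E x y} \<and> card {y. E x y} \<le> k)"

section \<open>The enumeration of the bounded ceers\<close>

definition gen_rel :: "nat \<Rightarrow> nat \<Rightarrow> nat \<Rightarrow> bool" where
  "gen_rel e = equivclp (\<lambda>x y. prod_encode (x, y) \<in> W e)"

definition gen_rel_stage :: "nat \<Rightarrow> nat \<Rightarrow> nat \<Rightarrow> nat \<Rightarrow> bool" where
  "gen_rel_stage e s = equivclp (\<lambda>x y. prod_encode (x, y) \<in> W_stage e s)"

text \<open>
  The enumeration of \<^term>\<open>gen_rel e\<close> runs over all \<open>t\<close>: the number \<open>t\<close> codes a triple
  \<open>x\<close>, \<open>y\<close>, \<open>s\<close>, and the pair \<open>(x, y)\<close> is enumerated at step \<open>t\<close> iff it is in \<^term>\<open>gen_rel_stage e s\<close>.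
  A pair is enumerated infinitely often, but the relation built only grows, so a pair that
  has once been omitted is omitted at each later step too.
\<close>

definition enumerated_at :: "nat \<Rightarrow> nat \<Rightarrow> nat \<Rightarrow> nat \<Rightarrow> bool" where
  "enumerated_at e t x y \<longleftrightarrow> (\<exists>s. t = prod_encode (prod_encode (x, y), s) \<and> gen_rel_stage e s x y)"

text \<open>At most one pair is enumerated at each step.\<close>

primrec bounded_ceer_stage :: "nat \<Rightarrow> nat \<Rightarrow> nat \<Rightarrow> nat \<Rightarrow> nat \<Rightarrow> bool" where
  "bounded_ceer_stage k e 0 = (=)"
| "bounded_ceer_stage k e (Suc t) =
     (let E = bounded_ceer_stage k e t;
          E' = equivclp (\<lambda>x y. E x y \<or> enumerated_at e t x y)
      in if k_bounded k E' then E' else E)"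

definition bounded_ceer :: "nat \<Rightarrow> nat \<Rightarrow> nat \<Rightarrow> nat \<Rightarrow> bool" where
  "bounded_ceer k e x y \<longleftrightarrow> (\<exists>t. bounded_ceer_stage k e t x y)"

definition bounded_ceer_inf :: "nat \<Rightarrow> nat \<Rightarrow> nat \<Rightarrow> bool" where
  "bounded_ceer_inf k u v \<longleftrightarrow>
     (\<exists>x y z. u = prod_encode (x, z) \<and> v = prod_encode (y, z) \<and> bounded_ceer k z x y)"

lemma equivp_bounded_ceer_stage: "equivp (bounded_ceer_stage k e t)"
  by (induction t) (auto simp: Let_def identity_equivp)

lemma bounded_ceer_stage_mono:
  assumes "s \<le> t" shows "bounded_ceer_stage k e s \<le> bounded_ceer_stage k e t"
  using assms
proof (induction t rule: dec_induct)
  case (step t)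
  have "bounded_ceer_stage k e t \<le> bounded_ceer_stage k e (Suc t)"
    by (auto simp: Let_def intro!: predicate2I r_into_equivclp)
  with step show ?case by (meson order_trans)
qed simp

lemma equivp_bounded_ceer: "equivp (bounded_ceer k e)"
proof (rule equivpI)
  note eq = equivp_bounded_ceer_stage[of k e]
  show "reflp (bounded_ceer k e)"
    unfolding bounded_ceer_def by (rule reflpI) (use equivp_reflp[OF eq] in blast)
  show "symp (bounded_ceer k e)"
    unfolding bounded_ceer_def by (rule sympI) (use equivp_symp[OF eq] in blast)
  show "transp (bounded_ceer k e)"
  proof (rule transpI)
    fix x y z assume "bounded_ceer k e x y" "bounded_ceer k e y z"
    then obtain s t where "bounded_ceer_stage k e s x y" "bounded_ceer_stage k e t y z"
      unfolding bounded_ceer_def by blast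
    then have "bounded_ceer_stage k e (max s t) x y" "bounded_ceer_stage k e (max s t) y z"
      using bounded_ceer_stage_mono[of s "max s t" k e] bounded_ceer_stage_mono[of t "max s t" k e]
      by (simp_all add: le_fun_def)
    then have "bounded_ceer_stage k e (max s t) x z" by (rule equivp_transp[OF eq])
    then show "bounded_ceer k e x z" unfolding bounded_ceer_def by blast
  qed
qed

lemma k_bounded_bounded_ceer:
  assumes "k > 0" shows "k_bounded k (bounded_ceer k e)"
proof -
  have st: "k_bounded k (bounded_ceer_stage k e t)" for t
    using assms by (induction t) (auto simp: Let_def k_bounded_def)
  have fin: "card A \<le> k" if "finite A" "A \<subseteq> {y. bounded_ceer k e x y}" for A x
  proof -
    from that have "\<exists>t. A \<subseteq> {y. bounded_ceer_stage k e t x y}"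
    proof (induction A rule: finite_induct)
      case (insert a A)
      then obtain s t where "A \<subseteq> {y. bounded_ceer_stage k e s x y}" "bounded_ceer_stage k e t x a"
        unfolding bounded_ceer_def by blast
      then have "insert a A \<subseteq> {y. bounded_ceer_stage k e (max s t) x y}"
        using bounded_ceer_stage_mono[of s "max s t" k e] bounded_ceer_stage_mono[of t "max s t" k e]
        by (simp add: le_fun_def subset_iff)
      then show ?case ..
    qed simp
    then show ?thesis using st unfolding k_bounded_def by (meson card_mono order_trans)
  qed
  have "finite {y. bounded_ceer k e x y}" for x
  proof (rule ccontr)
    assume "infinite {y. bounded_ceer k e x y}"
    then obtain A where "A \<subseteq> {y. bounded_ceer k e x y}" "finite A" "card A = Suc k"
      using infinite_arbitrarily_large by metis
    then show False using fin by (metis Suc_n_not_le_n)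
  qed
  then show ?thesis using fin unfolding k_bounded_def by blast
qed

lemma gen_rel_stage_le: "gen_rel_stage e s \<le> gen_rel e"
proof (rule predicate2I)
  fix x y assume "gen_rel_stage e s x y"
  then show "gen_rel e x y"
    unfolding gen_rel_stage_def gen_rel_def
    by (rule equivclp_induct) (auto intro: r_into_equivclp converse_r_into_equivclp equivclp_trans
        simp: W_eq_Union_W_stage)
qed

lemma bounded_ceer_stage_le: "bounded_ceer_stage k e t \<le> gen_rel e"
proof (induction t)
  case 0
  then show ?case by (auto simp: gen_rel_def)
next
  case (Suc t)
  have "equivclp (\<lambda>x y. bounded_ceer_stage k e t x y \<or> enumerated_at e t x y) x y \<Longrightarrow> gen_rel e x y"
    for x y
  proof (induction rule: equivclp_induct)
    case base
    then show ?case by (simp add: gen_rel_def)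
  next
    case (step y z)
    then have "gen_rel e y z \<or> gen_rel e z y"
      using Suc gen_rel_stage_le unfolding enumerated_at_def by blast
    with step.IH show ?case unfolding gen_rel_def by (meson equivclp_sym equivclp_trans)
  qed
  with Suc show ?case by (auto simp: Let_def)
qed

lemma bounded_ceer_eq_gen_rel:
  assumes "k_bounded k (gen_rel e)"
  shows "bounded_ceer k e = gen_rel e"
proof (intro antisym predicate2I)
  show "bounded_ceer k e x y \<Longrightarrow> gen_rel e x y" for x y
    using bounded_ceer_stage_le unfolding bounded_ceer_def by blast
next
  have sub: "k_bounded k E" if "E \<le> gen_rel e" for E
  proof -
    have "{y. E x y} \<subseteq> {y. gen_rel e x y}" for x using that by blast
    then show ?thesis using assms unfolding k_bounded_def by (meson card_mono finite_subset order_trans)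
  qed
  have base: "bounded_ceer k e x y" if "prod_encode (x, y) \<in> W e" for x y
  proof -
    from that obtain s where "prod_encode (x, y) \<in> W_stage e s"
      unfolding W_eq_Union_W_stage by blast
    then have "gen_rel_stage e s x y" unfolding gen_rel_stage_def by (rule r_into_equivclp)
    then have en: "enumerated_at e (prod_encode (prod_encode (x, y), s)) x y"
      unfolding enumerated_at_def by blast
    define t where "t = prod_encode (prod_encode (x, y), s)"
    define E' where "E' = equivclp (\<lambda>x y. bounded_ceer_stage k e t x y \<or> enumerated_at e t x y)"
    have "E' u v \<Longrightarrow> gen_rel e u v" for u v
      unfolding E'_def
    proof (induction rule: equivclp_induct)
      case base
      then show ?case by (simp add: gen_rel_def)
    next
      case (step y z)
      then have "gen_rel e y z \<or> gen_rel e z y"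
        using bounded_ceer_stage_le gen_rel_stage_le unfolding enumerated_at_def by blast
      with step.IH show ?case unfolding gen_rel_def by (meson equivclp_sym equivclp_trans)
    qed
    then have "k_bounded k E'" by (intro sub) blast
    then have "bounded_ceer_stage k e (Suc t) = E'" by (simp add: E'_def Let_def)
    moreover have "E' x y" unfolding E'_def using en t_def by (auto intro: r_into_equivclp)
    ultimately show ?thesis unfolding bounded_ceer_def by metis
  qed
  show "bounded_ceer k e x y" if "gen_rel e x y" for x y
    using that unfolding gen_rel_def
  proof (induction rule: equivclp_induct)
    case base
    then show ?case using equivp_reflp[OF equivp_bounded_ceer] by blast
  next
    case (step y z)
    then show ?case using base equivp_symp[OF equivp_bounded_ceer] equivp_transp[OF equivp_bounded_ceer] by blast
  qed
qed

lemma bounded_ceer_complete: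
  assumes "ceer E" "k_bounded k E"
  shows "\<exists>e. bounded_ceer k e = E"
proof -
  obtain e where e: "W e = {prod_encode (x, y) |x y. E x y}" and E: "equivp E"
    using assms(1) unfolding ceer_def by blast
  have W: "prod_encode (x, y) \<in> W e \<longleftrightarrow> E x y" for x y
    unfolding e by auto
  have "gen_rel e x y \<longleftrightarrow> E x y" for x y
  proof
    assume "gen_rel e x y"
    then show "E x y" unfolding gen_rel_def W
    proof (induction rule: equivclp_induct)
      case base show ?case by (rule equivp_reflp[OF E])
    next
      case (step y z) then show ?case using equivp_symp[OF E] equivp_transp[OF E] by blast
    qed
  qed (simp add: gen_rel_def W r_into_equivclp)
  then have "gen_rel e = E" by (intro ext) simp
  with assms(2) show ?thesis using bounded_ceer_eq_gen_rel by metis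
qed

section \<open>Halting jumps of the identity\<close>

definition halting_jump :: "(nat \<Rightarrow> nat \<Rightarrow> bool) \<Rightarrow> nat \<Rightarrow> nat \<Rightarrow> bool" where
  "halting_jump E x y \<longleftrightarrow>
     x = y \<or> (\<exists>a b. phi x x = Some a \<and> phi y y = Some b \<and> E a b)"

primrec omega_jump :: "nat \<Rightarrow> nat \<Rightarrow> nat \<Rightarrow> bool" where
  "omega_jump 0 = (=)"
| "omega_jump (Suc n) = halting_jump (omega_jump n)"

end

theory Submission
  imports Defs
begin

text \<open>
  On the column \<open>e\<close> a ceer with classes of size at most \<open>2 ^ (n + 1)\<close> defeats \<open>\<phi>\<^sub>e\<close> as a reduction to
  \<open>\<omega>\<^sup>(\<^sup>n\<^sup>)\<close>: it uses \<open>2 ^ (n + 1)\<close> elements, waits until their images are defined and distinct,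
  and then merges them in pairs. Two distinct numbers are related by \<open>E'\<close> only if both diagonal
  computations converge to \<open>E\<close>-related values, so \<open>\<phi>\<^sub>e\<close> now yields values that treat the \<open>2 ^ n\<close>
  pairs as single elements to be mapped to \<open>\<omega>\<^sup>(\<^sup>n\<^sup>-\<^sup>1\<^sup>)\<close>. The merging is repeated with these
  blocks; if values of different blocks ever coincide, it stops forever and \<open>\<phi>\<^sub>e\<close> is wrong.
  After \<open>n\<close> rounds two blocks are left whose values lie in \<open>\<omega>\<close> and differ; merging them refutes
  \<open>\<phi>\<^sub>e\<close>.
\<close>

section \<open>Computable functions and decidable predicates\<close>

abbreviation pair :: "nat \<Rightarrow> nat \<Rightarrow> nat" where
  "pair x y \<equiv> prod_encode (x, y)"

abbreviation pfst :: "nat \<Rightarrow> nat" where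
  "pfst x \<equiv> fst (prod_decode x)"

abbreviation psnd :: "nat \<Rightarrow> nat" where
  "psnd x \<equiv> snd (prod_decode x)"

lemma total_computable_iff:
  "total_computable f \<longleftrightarrow> (\<exists>p. \<forall>x. eval_in UNIV p x = Some (f x))"
  unfolding total_computable_def phi_def by (metis inv_f_f inj_gnum)

named_theorems computable

lemma total_computable_id [computable]: "total_computable (\<lambda>x. x)"
  \<comment> \<open>The identity is not a basic program; re-pairing the two projections yields
    it.\<close>
  unfolding total_computable_iff by (rule exI[of _ "rPair rFst rSnd"]) simp

lemma total_computable_comp:
  assumes "total_computable f" "total_computable g"
  shows "total_computable (\<lambda>x. f (g x))"
proof -
  from assms obtain p q where "\<forall>x. eval_in UNIV p x = Some (f x)" "\<forall>x. eval_in UNIV q x = Some (g x)"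
    unfolding total_computable_iff by blast
  then have "\<forall>x. eval_in UNIV (rComp p q) x = Some (f (g x))" by simp
  then show ?thesis unfolding total_computable_iff by blast
qed

lemma total_computable_Suc [computable]:
  "total_computable f \<Longrightarrow> total_computable (\<lambda>x. Suc (f x))"
  by (rule total_computable_comp[of Suc]) (auto simp: total_computable_iff intro: exI[of _ rSucc])

lemma total_computable_pfst [computable]:
  "total_computable f \<Longrightarrow> total_computable (\<lambda>x. pfst (f x))"
  by (rule total_computable_comp[of pfst]) (auto simp: total_computable_iff intro: exI[of _ rFst])

lemma total_computable_psnd [computable]:
  "total_computable f \<Longrightarrow> total_computable (\<lambda>x. psnd (f x))"
  by (rule total_computable_comp[of psnd]) (auto simp: total_computable_iff intro: exI[of _ rSnd])

lemma total_computable_const [computable]: "total_computable (\<lambda>x. c)"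
proof (induction c)
  case 0
  show ?case unfolding total_computable_iff by (rule exI[of _ rZero]) simp
qed (rule total_computable_Suc)

lemma total_computable_pair [computable]:
  assumes "total_computable f" "total_computable g"
  shows "total_computable (\<lambda>x. pair (f x) (g x))"
proof -
  from assms obtain p q where "\<forall>x. eval_in UNIV p x = Some (f x)" "\<forall>x. eval_in UNIV q x = Some (g x)"
    unfolding total_computable_iff by blast
  then have "\<forall>x. eval_in UNIV (rPair p q) x = Some (pair (f x) (g x))" by simp
  then show ?thesis unfolding total_computable_iff by blast
qed

text \<open>\<open>rPrec\<close> hands parameter, counter and previous value to its step as one
  nested pair, whence the shape of the third assumption. Running it on \<open>pair x (g x)\<close>
  lets start value, step and depth all depend on \<open>x\<close>.\<close>

lemma total_computable_rec_nat:
  assumes "total_computable f" "total_computable g"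
    and "total_computable (\<lambda>w. h (pfst w) (pfst (psnd w)) (psnd (psnd w)))"
  shows "total_computable (\<lambda>x. rec_nat (f x) (h x) (g x))"
proof -
  from assms(1,3) obtain p q where p: "\<And>x. eval_in UNIV p x = Some (f x)"
    and q: "\<And>w. eval_in UNIV q w = Some (h (pfst w) (pfst (psnd w)) (psnd (psnd w)))"
    unfolding total_computable_iff by blast
  have "rec_nat (eval_in UNIV p a) (\<lambda>i r. Option.bind r (\<lambda>v. eval_in UNIV q (pair a (pair i v)))) m
      = Some (rec_nat (f a) (h a) m)" for a m
    by (induction m) (simp_all add: p q)
  then have "eval_in UNIV (rPrec p q) w = Some (rec_nat (f (pfst w)) (h (pfst w)) (psnd w))" for w
    by (simp add: case_prod_unfold)
  then have "total_computable (\<lambda>w. rec_nat (f (pfst w)) (h (pfst w)) (psnd w))"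
    unfolding total_computable_iff by blast
  from total_computable_comp[OF this total_computable_pair[OF total_computable_id assms(2)]]
  show ?thesis by simp
qed

lemma total_computable_add [computable]:
  assumes "total_computable f" "total_computable g"
  shows "total_computable (\<lambda>x. f x + g x)"
proof -
  have "rec_nat a (\<lambda>i v. Suc v) b = a + b" for a b :: nat by (induction b) auto
  then show ?thesis
    using total_computable_rec_nat[OF assms, of "\<lambda>_ _ v. Suc v"] by (simp add: computable)
qed

lemma total_computable_diff [computable]:
  assumes "total_computable f" "total_computable g"
  shows "total_computable (\<lambda>x. f x - g x)"
proof -
  \<comment> \<open>The step returns the counter and ignores the previous value, which gives the
    predecessor.\<close>
  have pred: "rec_nat 0 (\<lambda>i v. i) b = b - 1" for b :: nat by (cases b) auto
  have "total_computable (\<lambda>x. x - 1)"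
    using total_computable_rec_nat[OF total_computable_const[of 0] total_computable_id, of "\<lambda>_ i v. i"]
    unfolding pred by (simp add: computable)
  then have *: "total_computable (\<lambda>w. psnd (psnd w) - 1)"
    by (rule total_computable_comp[of "\<lambda>x. x - 1"]) (intro computable)
  have "rec_nat a (\<lambda>i v. v - 1) b = a - b" for a b :: nat by (induction b) auto
  then show ?thesis
    using total_computable_rec_nat[OF assms, of "\<lambda>_ _ v. v - 1"] * by simp
qed

lemma total_computable_mult [computable]:
  assumes "total_computable f" "total_computable g"
  shows "total_computable (\<lambda>x. f x * g x)"
proof -
  have "rec_nat 0 (\<lambda>i v. v + a) b = a * b" for a b :: nat by (induction b) auto
  moreover have "total_computable (\<lambda>w. psnd (psnd w) + f (pfst w))"
    by (intro computable total_computable_comp[OF assms(1)])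
  ultimately show ?thesis
    using total_computable_rec_nat[OF total_computable_const[of 0] assms(2), of "\<lambda>x i v. v + f x"]
    by simp
qed

section \<open>Decidable predicates and bounded quantifiers\<close>

definition decidable :: "(nat \<Rightarrow> bool) \<Rightarrow> bool" where
  "decidable P \<longleftrightarrow> total_computable (\<lambda>x. of_bool (P x))"

lemma decidable_comp:
  "decidable P \<Longrightarrow> total_computable f \<Longrightarrow> decidable (\<lambda>x. P (f x))"
  unfolding decidable_def by (rule total_computable_comp)

lemma decidable_not [computable]:
  assumes "decidable P" shows "decidable (\<lambda>x. \<not> P x)"
proof -
  have "total_computable (\<lambda>x. 1 - of_bool (P x))"
    using assms unfolding decidable_def by (intro computable)
  moreover have "(\<lambda>x. 1 - of_bool (P x)) = (\<lambda>x. of_bool (\<not> P x) :: nat)" by auto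
  ultimately show ?thesis unfolding decidable_def by simp
qed

lemma decidable_conj [computable]:
  assumes "decidable P" "decidable Q" shows "decidable (\<lambda>x. P x \<and> Q x)"
proof -
  have "total_computable (\<lambda>x. of_bool (P x) * of_bool (Q x))"
    using assms unfolding decidable_def by (intro computable)
  moreover have "(\<lambda>x. of_bool (P x) * of_bool (Q x)) = (\<lambda>x. of_bool (P x \<and> Q x) :: nat)" by auto
  ultimately show ?thesis unfolding decidable_def by simp
qed

lemma decidable_disj [computable]:
  assumes "decidable P" "decidable Q" shows "decidable (\<lambda>x. P x \<or> Q x)"
  using decidable_not[OF decidable_conj[OF decidable_not decidable_not, OF assms]] by simp

lemma decidable_imp [computable]:
  assumes "decidable P" "decidable Q" shows "decidable (\<lambda>x. P x \<longrightarrow> Q x)"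
  using decidable_disj[OF decidable_not, OF assms] by simp

lemma decidable_less [computable]:
  assumes "total_computable f" "total_computable g" shows "decidable (\<lambda>x. f x < g x)"
proof -
  \<comment> \<open>Truncated subtraction from 1, applied twice, fixes 0 and sends every positive
    number to 1.\<close>
  have "total_computable (\<lambda>x. 1 - (1 - (g x - f x)))"
    using assms by (intro computable)
  moreover have "(\<lambda>x. 1 - (1 - (g x - f x))) = (\<lambda>x. of_bool (f x < g x))" by auto
  ultimately show ?thesis unfolding decidable_def by simp
qed

lemma decidable_eq [computable]:
  fixes f g :: "nat \<Rightarrow> nat"
  assumes "total_computable f" "total_computable g" shows "decidable (\<lambda>x. f x = g x)"
proof -
  have "decidable (\<lambda>x. \<not> f x < g x \<and> \<not> g x < f x)" using assms by (intro computable)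
  moreover have "(\<lambda>x. \<not> f x < g x \<and> \<not> g x < f x) = (\<lambda>x. f x = g x)" by auto
  ultimately show ?thesis by simp
qed

lemma decidable_bex [computable]:
  assumes "decidable (\<lambda>w. P (pfst w) (psnd w))" "total_computable f"
  shows "decidable (\<lambda>x. \<exists>y<f x. P x y)"
proof -
  \<comment> \<open>The recursion carries a flag that stays 1 once a witness has been met.\<close>
  define h where "h x i v = (of_bool (v = 1 \<or> P x i) :: nat)" for x i v :: nat
  have "decidable (\<lambda>w. P (pfst (pair (pfst w) (pfst (psnd w)))) (psnd (pair (pfst w) (pfst (psnd w)))))"
    by (rule decidable_comp[OF assms(1)]) (intro computable)
  then have "decidable (\<lambda>w. psnd (psnd w) = 1 \<or> P (pfst w) (pfst (psnd w)))"
    by (intro computable) simp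
  then have "total_computable (\<lambda>x. rec_nat 0 (h x) (f x))"
    by (intro total_computable_rec_nat total_computable_const assms(2)) (simp add: h_def decidable_def)
  moreover have "rec_nat 0 (h x) m = of_bool (\<exists>y<m. P x y)" for x m
    by (induction m) (auto simp: h_def less_Suc_eq)
  ultimately show ?thesis unfolding decidable_def by simp
qed

lemma decidable_ball [computable]:
  assumes "decidable (\<lambda>w. P (pfst w) (psnd w))" "total_computable f"
  shows "decidable (\<lambda>x. \<forall>y<f x. P x y)"
  using decidable_not[OF decidable_bex[OF decidable_not, OF assms]] by simp

text \<open>This gives access to the bits of a number. Parity alternates under \<open>1 - v\<close>,
  \<open>m div 2\<close> counts the odd numbers below \<open>m\<close>, and iterated halving yields
  the quotient.\<close>

lemma total_computable_div_power2 [computable]: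
  assumes "total_computable f" "total_computable g"
  shows "total_computable (\<lambda>x. f x div 2 ^ g x)"
proof -
  have par: "rec_nat 0 (\<lambda>i v. 1 - v) m = m mod 2" for m :: nat
    by (induction m) (auto simp: mod_Suc)
  have mod2: "total_computable (\<lambda>x. x mod 2)"
    using total_computable_rec_nat[OF total_computable_const[of 0] total_computable_id, of "\<lambda>_ i v. 1 - v"]
    unfolding par by (simp add: computable)
  have half: "rec_nat 0 (\<lambda>i v. v + i mod 2) m = m div 2" for m :: nat
  proof (induction m)
    case (Suc m)
    have "m div 2 + m mod 2 = Suc m div 2" by presburger
    with Suc show ?case by simp
  qed simp
  have "total_computable (\<lambda>w. psnd (psnd w) + pfst (psnd w) mod 2)"
    by (intro computable total_computable_comp[OF mod2])
  then have div2: "total_computable (\<lambda>x. x div 2)"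
    using total_computable_rec_nat[OF total_computable_const[of 0] total_computable_id,
        of "\<lambda>_ i v. v + i mod 2"]
    unfolding half by simp
  have "rec_nat a (\<lambda>i v. v div 2) m = a div 2 ^ m" for a m :: nat
    by (induction m) (simp_all add: div_mult2_eq mult.commute[of 2])
  moreover have "total_computable (\<lambda>w. psnd (psnd w) div 2)"
    by (intro computable total_computable_comp[OF div2])
  ultimately show ?thesis
    using total_computable_rec_nat[OF assms, of "\<lambda>_ i v. v div 2"] by simp
qed

lemma decidable_mem_set_decode [computable]:
  assumes "total_computable f" "total_computable g"
  shows "decidable (\<lambda>x. f x \<in> set_decode (g x))"
proof -
  have "decidable (\<lambda>x. \<not> (g x div 2 ^ f x = 2 * (g x div 2 ^ f x div 2 ^ 1)))"
    using assms by (intro computable)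
  moreover have "(m \<noteq> 2 * (m div 2 ^ 1)) = odd m" for m :: nat by simp presburger
  ultimately show ?thesis by (simp add: set_decode_def)
qed

section \<open>Semidecidable predicates\<close>

definition semidecidable :: "(nat \<Rightarrow> bool) \<Rightarrow> bool" where
  "semidecidable P \<longleftrightarrow>
     (\<exists>R. decidable (\<lambda>w. R (pfst w) (psnd w)) \<and> (\<forall>x. P x \<longleftrightarrow> (\<exists>y. R x y)))"

lemma semidecidableI:
  assumes "decidable (\<lambda>w. R (pfst w) (psnd w))" "\<And>x. P x \<longleftrightarrow> (\<exists>y. R x y)"
  shows "semidecidable P"
  using assms unfolding semidecidable_def by blast

text \<open>Decidability of \<open>R\<close> is offered for arbitrary computable arguments, so that
  it can serve as an introduction rule after witnesses are recoded.\<close>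

lemma semidecidableE:
  assumes "semidecidable P"
  obtains R where "\<And>f g. total_computable f \<Longrightarrow> total_computable g \<Longrightarrow> decidable (\<lambda>x. R (f x) (g x))"
    and "\<And>x. P x \<longleftrightarrow> (\<exists>y. R x y)"
proof -
  from assms obtain R where R: "decidable (\<lambda>w. R (pfst w) (psnd w))" "\<And>x. P x \<longleftrightarrow> (\<exists>y. R x y)"
    unfolding semidecidable_def by blast
  have "decidable (\<lambda>x. R (f x) (g x))" if "total_computable f" "total_computable g" for f g
    using decidable_comp[OF R(1) total_computable_pair[OF that]] by simp
  with R(2) show ?thesis by (rule that[rotated])
qed

text \<open>The characteristic function of the negated matrix is total, so minimization finds a zero
  of it exactly when a witness exists.\<close>

lemma semidecidable_imp_W:
  assumes "semidecidable P" shows "\<exists>e. W e = {x. P x}"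
proof -
  obtain R where R: "\<And>f g. total_computable f \<Longrightarrow> total_computable g \<Longrightarrow> decidable (\<lambda>x. R (f x) (g x))"
    and P: "\<And>x. P x \<longleftrightarrow> (\<exists>y. R x y)"
    using assms by (rule semidecidableE) blast
  have "decidable (\<lambda>w. \<not> R (pfst w) (psnd w))" by (intro computable R)
  then obtain p where p: "\<And>w. eval_in UNIV p w = Some (of_bool (\<not> R (pfst w) (psnd w)))"
    unfolding decidable_def total_computable_iff by blast
  have ev: "eval_in UNIV p (pair x z) = Some 0 \<longleftrightarrow> R x z"
    "(\<exists>v. eval_in UNIV p (pair x z) = Some (Suc v)) \<longleftrightarrow> \<not> R x z" for x z
    by (auto simp: p)
  have "eval_in UNIV (rMu p) x \<noteq> None \<longleftrightarrow> P x" for x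
  proof -
    have "eval_in UNIV (rMu p) x \<noteq> None \<longleftrightarrow> (\<exists>z. R x z \<and> (\<forall>y<z. \<not> R x y))"
      unfolding not_None_eq eval_in_Mu_iff ev by simp
    also have "\<dots> \<longleftrightarrow> (\<exists>z. R x z)" using exists_least_iff[of "R x"] by blast
    finally show ?thesis by (simp add: P)
  qed
  then have "W (gnum (rMu p)) = {x. P x}"
    unfolding W_def phi_def by (simp only: inv_f_f[OF inj_gnum])
  then show ?thesis ..
qed

lemma decidable_imp_semidecidable:
  assumes "decidable P" shows "semidecidable P"
  by (rule semidecidableI[of "\<lambda>x y. P x"])
    (simp_all add: decidable_comp[OF assms total_computable_pfst[OF total_computable_id]])

lemma semidecidable_comp:
  assumes "semidecidable P" "total_computable f" shows "semidecidable (\<lambda>x. P (f x))"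
proof -
  obtain R where R: "\<And>f g. total_computable f \<Longrightarrow> total_computable g \<Longrightarrow> decidable (\<lambda>x. R (f x) (g x))"
    and P: "\<And>x. P x \<longleftrightarrow> (\<exists>y. R x y)"
    using assms(1) by (rule semidecidableE) blast
  show ?thesis
    by (rule semidecidableI[of "\<lambda>x y. R (f x) y"])
      (auto simp: P intro!: R computable total_computable_comp[OF assms(2)])
qed

text \<open>One number codes a pair of witnesses.\<close>

lemma semidecidable_conj:
  assumes "semidecidable P" "semidecidable Q" shows "semidecidable (\<lambda>x. P x \<and> Q x)"
proof -
  obtain R where R: "\<And>f g. total_computable f \<Longrightarrow> total_computable g \<Longrightarrow> decidable (\<lambda>x. R (f x) (g x))"
    and P: "\<And>x. P x \<longleftrightarrow> (\<exists>y. R x y)"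
    using assms(1) by (rule semidecidableE) blast
  obtain S where S: "\<And>f g. total_computable f \<Longrightarrow> total_computable g \<Longrightarrow> decidable (\<lambda>x. S (f x) (g x))"
    and Q: "\<And>x. Q x \<longleftrightarrow> (\<exists>y. S x y)"
    using assms(2) by (rule semidecidableE) blast
  show ?thesis
  proof (rule semidecidableI[of "\<lambda>x y. R x (pfst y) \<and> S x (psnd y)"])
    show "decidable (\<lambda>w. R (pfst w) (pfst (psnd w)) \<and> S (pfst w) (psnd (psnd w)))"
      by (intro computable R S)
    show "P x \<and> Q x \<longleftrightarrow> (\<exists>y. R x (pfst y) \<and> S x (psnd y))" for x
      unfolding P Q by (metis fst_conv snd_conv prod_encode_inverse)
  qed
qed

lemma semidecidable_disj:
  assumes "semidecidable P" "semidecidable Q" shows "semidecidable (\<lambda>x. P x \<or> Q x)"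
proof -
  obtain R where R: "\<And>f g. total_computable f \<Longrightarrow> total_computable g \<Longrightarrow> decidable (\<lambda>x. R (f x) (g x))"
    and P: "\<And>x. P x \<longleftrightarrow> (\<exists>y. R x y)"
    using assms(1) by (rule semidecidableE) blast
  obtain S where S: "\<And>f g. total_computable f \<Longrightarrow> total_computable g \<Longrightarrow> decidable (\<lambda>x. S (f x) (g x))"
    and Q: "\<And>x. Q x \<longleftrightarrow> (\<exists>y. S x y)"
    using assms(2) by (rule semidecidableE) blast
  show ?thesis
    by (rule semidecidableI[of "\<lambda>x y. R x y \<or> S x y"]) (auto simp: P Q intro!: computable R S)
qed

lemma semidecidable_ex:
  assumes "semidecidable (\<lambda>w. P (pfst w) (psnd w))" shows "semidecidable (\<lambda>x. \<exists>y. P x y)"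
proof -
  obtain R where R: "\<And>f g. total_computable f \<Longrightarrow> total_computable g \<Longrightarrow> decidable (\<lambda>x. R (f x) (g x))"
    and P: "\<And>w. P (pfst w) (psnd w) \<longleftrightarrow> (\<exists>y. R w y)"
    using assms by (rule semidecidableE) blast
  show ?thesis
  proof (rule semidecidableI[of "\<lambda>x y. R (pair x (pfst y)) (psnd y)"])
    show "decidable (\<lambda>w. R (pair (pfst w) (pfst (psnd w))) (psnd (psnd w)))"
      by (intro computable R)
    have "P x y \<longleftrightarrow> (\<exists>z. R (pair x y) z)" for x y
      using P[of "pair x y"] by simp
    then show "(\<exists>y. P x y) \<longleftrightarrow> (\<exists>y. R (pair x (pfst y)) (psnd y))" for x
      by (metis fst_conv snd_conv prod_encode_inverse)
  qed
qed

text \<open>The index set does not vary with \<open>x\<close>, so the quantifier unfolds into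
  finitely many binary conjunctions.\<close>

lemma semidecidable_Ball:
  assumes "finite A" "\<And>a. a \<in> A \<Longrightarrow> semidecidable (P a)"
  shows "semidecidable (\<lambda>x. \<forall>a\<in>A. P a x)"
  using assms
proof (induction A rule: finite_induct)
  case empty
  have "decidable (\<lambda>x. 0 = (0::nat))" by (intro computable)
  then show ?case by (simp add: decidable_imp_semidecidable)
next
  case (insert a A)
  then show ?case using semidecidable_conj[of "P a" "\<lambda>x. \<forall>a\<in>A. P a x"] by simp
qed

lemma semidecidable_Bex:
  assumes "finite A" "\<And>a. a \<in> A \<Longrightarrow> semidecidable (P a)"
  shows "semidecidable (\<lambda>x. \<exists>a\<in>A. P a x)"
  using assms
proof (induction A rule: finite_induct)
  case empty
  have "decidable (\<lambda>x. 0 \<noteq> (0::nat))" by (intro computable)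
  then show ?case by (simp add: decidable_imp_semidecidable)
next
  case (insert a A)
  then show ?case using semidecidable_disj[of "P a" "\<lambda>x. \<exists>a\<in>A. P a x"] by simp
qed

section \<open>The universal function\<close>

abbreviation triple :: "nat \<Rightarrow> nat \<Rightarrow> nat \<Rightarrow> nat" where
  "triple g x y \<equiv> pair g (pair x y)"

text \<open>
  A triple \<open>(g, x, y)\<close> claims that the program with number \<open>g\<close> maps \<open>x\<close> to \<open>y\<close>. It is justified
  by a set of claims if it follows from them by one step of the evaluation. No derivation order is
  needed: the supporting claims concern subprograms or, for \<^const>\<open>rPrec\<close>, a smaller
  recursion argument, so a set of claims that justifies all its elements is sound. The quotient
  is written \<open>g div 2 ^ 2\<close> because division by powers of 2 is the form shown computable above.
\<close>

definition justified :: "nat set \<Rightarrow> nat \<Rightarrow> nat \<Rightarrow> nat \<Rightarrow> bool" where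
  "justified S g x y \<longleftrightarrow>
     g = 0 \<and> y = 0 \<or> g = 1 \<and> y = Suc x \<or> g = 2 \<and> y = pfst x \<or> g = 3 \<and> y = psnd x \<or>
     (let k = g div 2 ^ 2 - 1; a = pfst k; b = psnd k in
       g = 4 + 4 * k \<and> triple a x (pfst y) \<in> S \<and> triple b x (psnd y) \<in> S \<or>
       g = 5 + 4 * k \<and> (\<exists>u. triple b x u \<in> S \<and> triple a u y \<in> S) \<or>
       g = 6 + 4 * k \<and> psnd x = 0 \<and> triple a (pfst x) y \<in> S \<or>
       g = 6 + 4 * k \<and> 0 < psnd x \<and>
         (\<exists>v. triple g (pair (pfst x) (psnd x - 1)) v \<in> S \<and>
              triple b (pair (pfst x) (pair (psnd x - 1) v)) y \<in> S) \<or>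
       g = 7 + 4 * k \<and> triple k (pair x y) 0 \<in> S \<and> (\<forall>z<y. \<exists>v. triple k (pair x z) (Suc v) \<in> S))"

text \<open>Compound programs are told apart by the residue of their number modulo 4, and
  \<open>g div 2 ^ 2 - 1\<close> recovers the code of the parts. Only the disjuncts of the
  constructor at hand survive, and they mirror its evaluation equation.\<close>

lemma justified_gnum:
  "justified S (gnum rZero) x y \<longleftrightarrow> y = 0"
  "justified S (gnum rSucc) x y \<longleftrightarrow> y = Suc x"
  "justified S (gnum rFst) x y \<longleftrightarrow> y = pfst x"
  "justified S (gnum rSnd) x y \<longleftrightarrow> y = psnd x"
  "justified S (gnum (rPair p q)) x y \<longleftrightarrow>
     triple (gnum p) x (pfst y) \<in> S \<and> triple (gnum q) x (psnd y) \<in> S"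
  "justified S (gnum (rComp p q)) x y \<longleftrightarrow>
     (\<exists>u. triple (gnum q) x u \<in> S \<and> triple (gnum p) u y \<in> S)"
  "justified S (gnum (rPrec p q)) (pair a 0) y \<longleftrightarrow> triple (gnum p) a y \<in> S"
  "justified S (gnum (rPrec p q)) (pair a (Suc m)) y \<longleftrightarrow>
     (\<exists>v. triple (gnum (rPrec p q)) (pair a m) v \<in> S \<and> triple (gnum q) (pair a (pair m v)) y \<in> S)"
  "justified S (gnum (rMu p)) x y \<longleftrightarrow>
     triple (gnum p) (pair x y) 0 \<in> S \<and> (\<forall>z<y. \<exists>v. triple (gnum p) (pair x z) (Suc v) \<in> S)"
proof -
  have k: "(4 + 4 * k) div 2 ^ 2 - 1 = k" "(5 + 4 * k) div 2 ^ 2 - 1 = k"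
    "(6 + 4 * k) div 2 ^ 2 - 1 = k" "(7 + 4 * k) div 2 ^ 2 - 1 = k" for k :: nat
    by simp_all
  show "justified S (gnum rZero) x y \<longleftrightarrow> y = 0"
    "justified S (gnum rSucc) x y \<longleftrightarrow> y = Suc x"
    "justified S (gnum rFst) x y \<longleftrightarrow> y = pfst x"
    "justified S (gnum rSnd) x y \<longleftrightarrow> y = psnd x"
    unfolding justified_def by (simp_all add: Let_def)
  show "justified S (gnum (rPair p q)) x y \<longleftrightarrow>
      triple (gnum p) x (pfst y) \<in> S \<and> triple (gnum q) x (psnd y) \<in> S"
    unfolding justified_def gnum.simps k Let_def by simp
  show "justified S (gnum (rComp p q)) x y \<longleftrightarrow>
      (\<exists>u. triple (gnum q) x u \<in> S \<and> triple (gnum p) u y \<in> S)"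
    unfolding justified_def gnum.simps k Let_def by simp
  show "justified S (gnum (rPrec p q)) (pair a 0) y \<longleftrightarrow> triple (gnum p) a y \<in> S"
    unfolding justified_def gnum.simps k Let_def by simp
  show "justified S (gnum (rPrec p q)) (pair a (Suc m)) y \<longleftrightarrow>
      (\<exists>v. triple (gnum (rPrec p q)) (pair a m) v \<in> S \<and> triple (gnum q) (pair a (pair m v)) y \<in> S)"
    unfolding justified_def gnum.simps k Let_def by simp
  show "justified S (gnum (rMu p)) x y \<longleftrightarrow>
      triple (gnum p) (pair x y) 0 \<in> S \<and> (\<forall>z<y. \<exists>v. triple (gnum p) (pair x z) (Suc v) \<in> S)"
    unfolding justified_def gnum.simps k Let_def by simp
qed

text \<open>\<open>S\<close> occurs only positively in \<open>justified\<close>.\<close>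

lemma justified_mono:
  assumes "S \<subseteq> S'" "justified S g x y" shows "justified S' g x y"
proof -
  have "justified S g x y \<longrightarrow> justified S' g x y"
    unfolding justified_def Let_def
    by (intro disj_mono conj_mono ex_mono all_mono imp_mono in_mono[OF assms(1)] imp_refl)
  with assms(2) show ?thesis by blast
qed

text \<open>A finite set of this kind is a certificate: a computation trace whose correctness is
  checked locally.\<close>

definition closed_claims :: "nat set \<Rightarrow> bool" where
  "closed_claims S \<longleftrightarrow> (\<forall>g x y. triple g x y \<in> S \<longrightarrow> justified S g x y)"

lemma closed_claimsD: "closed_claims S \<Longrightarrow> triple g x y \<in> S \<Longrightarrow> justified S g x y"
  unfolding closed_claims_def by blast

lemma closed_claims_sound:
  assumes "closed_claims S" "triple (gnum p) x y \<in> S"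
  shows "eval_in UNIV p x = Some y"
  using assms(2)
proof (induction p arbitrary: x y)
  case (rPrec p q)
  obtain a m where x: "x = pair a m" by (metis prod_decode_inverse surj_pair)
  \<comment> \<open>A claim about \<open>rPrec\<close> may rest on one about the same program, so
    the recursion argument needs its own induction.\<close>
  have "triple (gnum (rPrec p q)) (pair a m) y \<in> S \<Longrightarrow> eval_in UNIV (rPrec p q) (pair a m) = Some y"
    for y
  proof (induction m arbitrary: y)
    case 0
    then have "justified S (gnum (rPrec p q)) (pair a 0) y" by (intro closed_claimsD[OF assms(1)])
    then show ?case using rPrec.IH unfolding justified_gnum by simp
  next
    case (Suc m)
    then have "justified S (gnum (rPrec p q)) (pair a (Suc m)) y" by (intro closed_claimsD[OF assms(1)])
    then obtain v where v: "triple (gnum (rPrec p q)) (pair a m) v \<in> S"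
      "triple (gnum q) (pair a (pair m v)) y \<in> S"
      unfolding justified_gnum by blast
    from Suc.IH[OF v(1)] rPrec.IH(2)[OF v(2)] show ?case by simp
  qed
  with rPrec.prems show ?case by (simp only: x)
next
  case (rMu p)
  then have "justified S (gnum (rMu p)) x y" by (intro closed_claimsD[OF assms(1)])
  with rMu.IH show ?case unfolding justified_gnum eval_in_Mu_iff by blast
next
  case (rPair p q)
  then have "justified S (gnum (rPair p q)) x y" by (intro closed_claimsD[OF assms(1)])
  then have "eval_in UNIV p x = Some (pfst y)" "eval_in UNIV q x = Some (psnd y)"
    using rPair.IH unfolding justified_gnum by blast+
  then show ?case by simp
next
  case (rComp p q)
  then have "justified S (gnum (rComp p q)) x y" by (intro closed_claimsD[OF assms(1)])
  with rComp.IH show ?case unfolding justified_gnum by auto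
qed (drule closed_claimsD[OF assms(1)], simp only: justified_gnum eval_in.simps)+

text \<open>The claims that have a finite certificate. Their set is shown to contain whatever it
  justifies, so that completeness becomes an induction on programs.\<close>

definition derivable :: "nat set" where
  "derivable = \<Union>{S. finite S \<and> closed_claims S}"

text \<open>By monotonicity of justification, certificates can be merged by union.\<close>

lemma finite_subset_derivable:
  assumes "finite F" "F \<subseteq> derivable"
  shows "\<exists>S. finite S \<and> closed_claims S \<and> F \<subseteq> S"
  using assms
proof (induction F rule: finite_induct)
  case empty
  have "closed_claims {}" by (simp add: closed_claims_def)
  then show ?case by blast
next
  case (insert t F)
  then obtain S S' where "finite S" "closed_claims S" "F \<subseteq> S" "finite S'" "closed_claims S'" "t \<in> S'"
    unfolding derivable_def by blast
  moreover from this have "closed_claims (S \<union> S')"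
    using justified_mono[of S "S \<union> S'"] justified_mono[of S' "S \<union> S'"]
    unfolding closed_claims_def by blast
  ultimately show ?case by (intro exI[of _ "S \<union> S'"]) auto
qed

text \<open>Compactness of one evaluation step: even minimization consults only the arguments up to
  \<open>y\<close>.\<close>

lemma justified_finitary:
  assumes "justified D g x y"
  shows "\<exists>F. finite F \<and> F \<subseteq> D \<and> justified F g x y"
proof -
  define k where "k = g div 2 ^ 2 - 1"
  note def = justified_def Let_def k_def[symmetric]
  from assms[unfolded def] consider
      "g = 0 \<and> y = 0 \<or> g = 1 \<and> y = Suc x \<or> g = 2 \<and> y = pfst x \<or> g = 3 \<and> y = psnd x"
    | "g = 4 + 4 * k" "triple (pfst k) x (pfst y) \<in> D" "triple (psnd k) x (psnd y) \<in> D"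
    | u where "g = 5 + 4 * k" "triple (psnd k) x u \<in> D" "triple (pfst k) u y \<in> D"
    | "g = 6 + 4 * k" "psnd x = 0" "triple (pfst k) (pfst x) y \<in> D"
    | v where "g = 6 + 4 * k" "0 < psnd x" "triple g (pair (pfst x) (psnd x - 1)) v \<in> D"
        "triple (psnd k) (pair (pfst x) (pair (psnd x - 1) v)) y \<in> D"
    | "g = 7 + 4 * k" "triple k (pair x y) 0 \<in> D" "\<forall>z<y. \<exists>v. triple k (pair x z) (Suc v) \<in> D"
    by (elim disjE exE conjE) iprover+
  then show ?thesis
  proof cases
    case 1
    then have "justified {} g x y" unfolding def by iprover
    then show ?thesis by blast
  next
    case 2
    then have "justified {triple (pfst k) x (pfst y), triple (psnd k) x (psnd y)} g x y"
      unfolding def by auto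
    with 2 show ?thesis by (intro exI conjI) auto
  next
    case (3 u)
    then have "justified {triple (psnd k) x u, triple (pfst k) u y} g x y"
      unfolding def by auto
    with 3 show ?thesis by (intro exI conjI) auto
  next
    case 4
    then have "justified {triple (pfst k) (pfst x) y} g x y" unfolding def by auto
    with 4 show ?thesis by (intro exI conjI) auto
  next
    case (5 v)
    let ?F = "{triple g (pair (pfst x) (psnd x - 1)) v,
        triple (psnd k) (pair (pfst x) (pair (psnd x - 1) v)) y}"
    have "\<exists>v. triple g (pair (pfst x) (psnd x - 1)) v \<in> ?F \<and>
        triple (psnd k) (pair (pfst x) (pair (psnd x - 1) v)) y \<in> ?F"
      by blast
    then have "justified ?F g x y" using 5(1,2) unfolding def by iprover
    with 5 show ?thesis by (intro exI conjI) auto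
  next
    case 6
    then obtain v where v: "\<And>z. z < y \<Longrightarrow> triple k (pair x z) (Suc (v z)) \<in> D" by metis
    let ?F = "insert (triple k (pair x y) 0) ((\<lambda>z. triple k (pair x z) (Suc (v z))) ` {..<y})"
    have "triple k (pair x y) 0 \<in> ?F" "\<forall>z<y. \<exists>v. triple k (pair x z) (Suc v) \<in> ?F" by blast+
    then have "justified ?F g x y" using 6(1) unfolding def by iprover
    moreover have "?F \<subseteq> D" using 6(2) v by blast
    moreover have "finite ?F" by simp
    ultimately show ?thesis by iprover
  qed
qed

text \<open>The finitely many supporting claims share one certificate; adding the new claim to it
  gives a certificate again.\<close>

lemma derivable_if_justified:
  assumes "justified derivable g x y" shows "triple g x y \<in> derivable"
proof -
  obtain F where F: "finite F" "F \<subseteq> derivable" "justified F g x y"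
    using justified_finitary[OF assms] by blast
  obtain S where S: "finite S" "closed_claims S" "F \<subseteq> S"
    using finite_subset_derivable[OF F(1,2)] by iprover
  let ?S = "insert (triple g x y) S"
  have "justified ?S g' x' y'" if "triple g' x' y' \<in> ?S" for g' x' y'
  proof (cases "triple g' x' y' \<in> S")
    case True
    show ?thesis by (rule justified_mono[OF subset_insertI closed_claimsD[OF S(2) True]])
  next
    case False
    with that have "g' = g" "x' = x" "y' = y" by auto
    moreover have "F \<subseteq> ?S" using S(3) by blast
    ultimately show ?thesis using justified_mono[OF _ F(3), of ?S] by simp
  qed
  then have "closed_claims ?S" unfolding closed_claims_def by blast
  with S(1) show ?thesis unfolding derivable_def by (intro UnionI[of ?S]) auto
qed

lemma derivable_complete:
  "eval_in UNIV p x = Some y \<Longrightarrow> triple (gnum p) x y \<in> derivable"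
proof (induction p arbitrary: x y)
  case (rPrec p q)
  obtain a m where x: "x = pair a m" by (metis prod_decode_inverse surj_pair)
  have "eval_in UNIV (rPrec p q) (pair a m) = Some y \<Longrightarrow>
      triple (gnum (rPrec p q)) (pair a m) y \<in> derivable" for y
  proof (induction m arbitrary: y)
    case 0
    then have "justified derivable (gnum (rPrec p q)) (pair a 0) y"
      using rPrec.IH(1) unfolding justified_gnum by simp
    then show ?case by (rule derivable_if_justified)
  next
    case (Suc m)
    then obtain v where "eval_in UNIV (rPrec p q) (pair a m) = Some v"
      "eval_in UNIV q (pair a (pair m v)) = Some y"
      by (auto simp: Option.bind_eq_Some_conv)
    with Suc.IH rPrec.IH(2) have "justified derivable (gnum (rPrec p q)) (pair a (Suc m)) y"
      unfolding justified_gnum by blast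
    then show ?case by (rule derivable_if_justified)
  qed
  with rPrec.prems show ?case by (simp only: x)
next
  case (rMu p)
  then have "justified derivable (gnum (rMu p)) x y"
    unfolding justified_gnum eval_in_Mu_iff by blast
  then show ?case by (rule derivable_if_justified)
next
  case (rPair p q)
  then have "justified derivable (gnum (rPair p q)) x y"
    unfolding justified_gnum by (auto simp: Option.bind_eq_Some_conv)
  then show ?case by (rule derivable_if_justified)
next
  case (rComp p q)
  then obtain u where "eval_in UNIV q x = Some u" "eval_in UNIV p u = Some y"
    by (auto simp: Option.bind_eq_Some_conv)
  with rComp.IH have "justified derivable (gnum (rComp p q)) x y"
    unfolding justified_gnum by blast
  then show ?case by (rule derivable_if_justified)
qed (rule derivable_if_justified, unfold justified_gnum, simp)+

text \<open>A normal form theorem: the code \<open>c\<close> of a finite certificate plays the role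
  of the computation code in Kleene's T predicate.\<close>

lemma phi_eq_Some_iff:
  "phi e x = Some y \<longleftrightarrow> (\<exists>c. closed_claims (set_decode c) \<and> triple e x y \<in> set_decode c)"
proof
  have e: "gnum (inv gnum e) = e" using surj_gnum by (rule surj_f_inv_f)
  show "phi e x = Some y" if "\<exists>c. closed_claims (set_decode c) \<and> triple e x y \<in> set_decode c"
    using that closed_claims_sound[of _ "inv gnum e" x y] unfolding phi_def e by blast
  assume "phi e x = Some y"
  then have "triple e x y \<in> derivable"
    using derivable_complete[of "inv gnum e"] unfolding phi_def e by blast
  then obtain S where S: "finite S" "closed_claims S" "triple e x y \<in> S"
    unfolding derivable_def by blast
  then have "set_decode (set_encode S) = S" by simp
  with S show "\<exists>c. closed_claims (set_decode c) \<and> triple e x y \<in> set_decode c" by metis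
qed

text \<open>Bit \<open>t\<close> of \<open>c\<close> can be set only if \<open>2 ^ t <= c\<close>,
  and \<open>t < 2 ^ t\<close>.\<close>

lemma mem_set_decode_less: "t \<in> set_decode c \<Longrightarrow> t < c"
proof (rule ccontr)
  assume "t \<in> set_decode c" "\<not> t < c"
  moreover from this have "c < 2 ^ t" using less_exp[of t] by (meson le_less_trans not_le)
  ultimately show False by (simp add: set_decode_def)
qed

lemma triple_mem_set_decode_less:
  assumes "triple g x y \<in> set_decode c" shows "g < c" "x < c" "y < c"
  using mem_set_decode_less[OF assms] le_prod_encode_1[of g "pair x y"] le_prod_encode_2[of "pair x y" g]
    le_prod_encode_1[of x y] le_prod_encode_2[of y x] by linarith+

text \<open>These rules bound the two shapes of unbounded quantifier in \<open>justified\<close>, so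
  that its decidability follows from the closure rules.\<close>

lemma ex_triple_mem_set_decode:
  "(\<exists>u. triple g x u \<in> set_decode c \<and> P u) \<longleftrightarrow> (\<exists>u<c. triple g x u \<in> set_decode c \<and> P u)"
  "(\<exists>u. triple g x (Suc u) \<in> set_decode c) \<longleftrightarrow> (\<exists>u<c. triple g x (Suc u) \<in> set_decode c)"
  by (metis triple_mem_set_decode_less(3)) (metis Suc_lessD triple_mem_set_decode_less(3))

lemma decidable_closed_claims: "decidable (\<lambda>c. closed_claims (set_decode c))"
proof -
  have "decidable (\<lambda>c. \<forall>g<c. \<forall>x<c. \<forall>y<c. triple g x y \<in> set_decode c \<longrightarrow> justified (set_decode c) g x y)"
    unfolding justified_def Let_def ex_triple_mem_set_decode by (intro computable)
  moreover have "closed_claims (set_decode c) \<longleftrightarrow>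
      (\<forall>g<c. \<forall>x<c. \<forall>y<c. triple g x y \<in> set_decode c \<longrightarrow> justified (set_decode c) g x y)" for c
    unfolding closed_claims_def using triple_mem_set_decode_less by metis
  ultimately show ?thesis by simp
qed

lemma semidecidable_phi:
  assumes "total_computable f" "total_computable g" "total_computable h"
  shows "semidecidable (\<lambda>x. phi (f x) (g x) = Some (h x))"
proof -
  have "semidecidable (\<lambda>w. phi (pfst w) (pfst (psnd w)) = Some (psnd (psnd w)))"
    by (rule semidecidableI[of "\<lambda>w c. closed_claims (set_decode c) \<and>
          triple (pfst w) (pfst (psnd w)) (psnd (psnd w)) \<in> set_decode c"],
        intro computable decidable_comp[OF decidable_closed_claims], subst phi_eq_Some_iff, rule refl)
  moreover have "total_computable (\<lambda>x. triple (f x) (g x) (h x))"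
    using assms by (intro computable)
  ultimately have "semidecidable (\<lambda>x. phi (pfst (triple (f x) (g x) (h x)))
      (pfst (psnd (triple (f x) (g x) (h x)))) = Some (psnd (psnd (triple (f x) (g x) (h x)))))"
    by (rule semidecidable_comp)
  then show ?thesis by simp
qed

section \<open>The diagonal ceer\<close>

text \<open>
  The number \<open>pair e x\<close> is the element \<open>x\<close> of column \<open>e\<close>. After \<open>j\<close> rounds of merging, the blocks
  are the sets of \<open>x < 2 ^ m\<close> with a common \<open>x div 2 ^ j\<close>.
\<close>

primrec iterate_val :: "nat \<Rightarrow> nat \<Rightarrow> nat option" where
  "iterate_val 0 u = phi (pfst u) u"
| "iterate_val (Suc j) u = Option.bind (iterate_val j u) (\<lambda>a. phi a a)"

text \<open>The event that permits the merging after round \<open>i\<close>. Since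
  \<open>iterate_val\<close> takes its first index from the column, level 0 consists of the values
  of \<open>phi e\<close> on column \<open>e\<close> itself. Quantifying over fixed finite sets
  keeps the event semidecidable.\<close>

definition separated :: "nat \<Rightarrow> nat \<Rightarrow> nat \<Rightarrow> bool" where
  "separated m i e \<longleftrightarrow> (\<forall>x\<in>{..<2 ^ m}. \<forall>y\<in>{..<2 ^ m}. \<exists>a b. iterate_val i (pair e x) = Some a \<and>
     iterate_val i (pair e y) = Some b \<and> (x div 2 ^ i \<noteq> y div 2 ^ i \<longrightarrow> a \<noteq> b))"

text \<open>A closed form of the staged merging: \<open>j\<close> rounds put both elements into one
  block, and each of these rounds was permitted.\<close>

definition diag_ceer :: "nat \<Rightarrow> nat \<Rightarrow> nat \<Rightarrow> bool" where
  "diag_ceer m u v \<longleftrightarrow> u = v \<or>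
     pfst u = pfst v \<and> psnd u < 2 ^ m \<and> psnd v < 2 ^ m \<and>
     (\<exists>j\<in>{..m}. psnd u div 2 ^ j = psnd v div 2 ^ j \<and> (\<forall>i\<in>{..<j}. separated m i (pfst u)))"

text \<open>Blocks only coarsen from round to round.\<close>

lemma div_power2_mono:
  fixes x y :: nat
  assumes "x div 2 ^ i = y div 2 ^ i" "i \<le> j" shows "x div 2 ^ j = y div 2 ^ j"
proof -
  have "z div 2 ^ j = z div 2 ^ i div 2 ^ (j - i)" for z :: nat
    using assms(2) by (metis div_mult2_eq le_add_diff_inverse power_add)
  with assms(1) show ?thesis by simp
qed

text \<open>Provides an element of the block that is merged with the block of \<open>x\<close> in
  the next round.\<close>

lemma ex_sibling_block:
  fixes x :: nat
  assumes "x < 2 ^ m" "j < m"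
  obtains y where "y < 2 ^ m" "y div 2 ^ Suc j = x div 2 ^ Suc j" "y div 2 ^ j \<noteq> x div 2 ^ j"
proof
  define q where "q = x div 2 ^ j"
  \<comment> \<open>Flipping the last bit of the block number gives the sibling;
    \<open>q' * 2 ^ j\<close> is the least element of that block.\<close>
  define q' where "q' = (if even q then Suc q else q - 1)"
  have div: "z div 2 ^ Suc j = z div 2 ^ j div 2" for z :: nat
    by (simp only: power_Suc2 div_mult2_eq)
  have q': "q' div 2 = q div 2" "q' \<noteq> q" unfolding q'_def by (auto elim!: evenE oddE)
  have *: "q' * 2 ^ j div 2 ^ j = q'" by simp
  show "q' * 2 ^ j div 2 ^ j \<noteq> x div 2 ^ j" using q' unfolding * q_def by simp
  show eq: "q' * 2 ^ j div 2 ^ Suc j = x div 2 ^ Suc j" using q' unfolding div * q_def by simp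
  \<comment> \<open>Elements in one block after round \<open>Suc j\<close> still share a block after
    round \<open>m\<close>, and that of \<open>x\<close> has number 0.\<close>
  have "x div 2 ^ m = 0" using assms(1) by simp
  then have "q' * 2 ^ j div 2 ^ m = 0" using div_power2_mono[OF eq, of m] assms(2) by simp
  then show "q' * 2 ^ j < 2 ^ m" by (simp add: div_eq_0_iff)
qed

section \<open>The diagonal relation as a bounded ceer\<close>

lemma equivp_diag_ceer: "equivp (diag_ceer m)"
proof (rule equivpI)
  show "reflp (diag_ceer m)" by (rule reflpI) (simp add: diag_ceer_def)
  show "symp (diag_ceer m)" by (rule sympI) (unfold diag_ceer_def, metis)
  show "transp (diag_ceer m)"
  proof (rule transpI)
    fix u v w assume uv: "diag_ceer m u v" and vw: "diag_ceer m v w"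
    show "diag_ceer m u w"
    proof (cases "u = v \<or> v = w")
      case False
      then obtain j j' where j: "j \<le> m" "j' \<le> m" "psnd u div 2 ^ j = psnd v div 2 ^ j"
          "psnd v div 2 ^ j' = psnd w div 2 ^ j'"
          "\<forall>i<j. separated m i (pfst u)" "\<forall>i<j'. separated m i (pfst u)"
        and *: "pfst u = pfst w" "psnd u < 2 ^ m" "psnd w < 2 ^ m"
        using uv vw unfolding diag_ceer_def by auto
      \<comment> \<open>The later of the two rounds puts all three elements into one block.\<close>
      have "psnd u div 2 ^ max j j' = psnd w div 2 ^ max j j'"
        using div_power2_mono[OF j(3), of "max j j'"] div_power2_mono[OF j(4), of "max j j'"] by simp
      moreover have "\<forall>i\<in>{..<max j j'}. separated m i (pfst u)" "max j j' \<in> {..m}"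
        using j by (auto simp: less_max_iff_disj)
      ultimately show ?thesis using * unfolding diag_ceer_def by blast
    qed (use uv vw in auto)
  qed
qed

lemma k_bounded_diag_ceer: "k_bounded (2 ^ m) (diag_ceer m)"
  unfolding k_bounded_def
proof
  fix u
  show "finite {v. diag_ceer m u v} \<and> card {v. diag_ceer m u v} \<le> 2 ^ m"
  proof (cases "psnd u < 2 ^ m")
    case True
    have "{v. diag_ceer m u v} \<subseteq> pair (pfst u) ` {..<2 ^ m}"
    proof
      fix v assume "v \<in> {v. diag_ceer m u v}"
      with True have "pfst v = pfst u" "psnd v < 2 ^ m" by (auto simp: diag_ceer_def)
      then show "v \<in> pair (pfst u) ` {..<2 ^ m}"
        by (metis imageI lessThan_iff prod.collapse prod_decode_inverse)
    qed
    moreover have "card (pair (pfst u) ` {..<2 ^ m}) \<le> 2 ^ m"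
      using card_image_le[of "{..<2 ^ m}" "pair (pfst u)"] by simp
    ultimately show ?thesis
      by (meson card_mono finite_imageI finite_lessThan finite_subset order_trans)
  next
    case False
    then have "{v. diag_ceer m u v} = {u}" by (auto simp: diag_ceer_def)
    then show ?thesis by simp
  qed
qed

text \<open>The induction varies \<open>f\<close> and \<open>g\<close> because the intermediate
  value becomes a component of the argument.\<close>

lemma semidecidable_iterate_val:
  assumes "total_computable f" "total_computable g"
  shows "semidecidable (\<lambda>w. iterate_val j (f w) = Some (g w))"
  using assms
proof (induction j arbitrary: f g)
  case 0
  then show ?case unfolding iterate_val.simps by (intro semidecidable_phi computable)
next
  case (Suc j)
  have "semidecidable (\<lambda>w. iterate_val j (f (pfst w)) = Some (psnd w) \<and>
      phi (psnd w) (psnd w) = Some (g (pfst w)))"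
    by (intro semidecidable_conj Suc.IH semidecidable_phi computable
        total_computable_comp[OF Suc.prems(1)] total_computable_comp[OF Suc.prems(2)])
  then have "semidecidable (\<lambda>w. \<exists>a. iterate_val j (f w) = Some a \<and> phi a a = Some (g w))"
    by (rule semidecidable_ex)
  then show ?case by (simp add: Option.bind_eq_Some_conv)
qed

lemma semidecidable_separated: "semidecidable (separated m i)"
proof -
  have "semidecidable (\<lambda>e. \<exists>a b. iterate_val i (pair e x) = Some a \<and>
     iterate_val i (pair e y) = Some b \<and> (x div 2 ^ i \<noteq> y div 2 ^ i \<longrightarrow> a \<noteq> b))" for x y
    by (intro semidecidable_ex semidecidable_conj semidecidable_iterate_val
        decidable_imp_semidecidable computable)
  then show ?thesis unfolding separated_def by (intro semidecidable_Ball finite_lessThan)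
qed

lemma ceer_diag_ceer: "ceer (diag_ceer m)"
proof -
  have "semidecidable (\<lambda>w. diag_ceer m (pfst w) (psnd w))"
    unfolding diag_ceer_def
    by (intro semidecidable_disj semidecidable_conj semidecidable_Bex semidecidable_Ball
        semidecidable_comp[OF semidecidable_separated])
      (auto intro!: decidable_imp_semidecidable computable)
  then obtain e where "W e = {w. diag_ceer m (pfst w) (psnd w)}"
    using semidecidable_imp_W by blast
  also have "\<dots> = {pair x y |x y. diag_ceer m x y}"
    by auto (metis prod.collapse prod_decode_inverse)
  finally show ?thesis using equivp_diag_ceer unfolding ceer_def by blast
qed

section \<open>Defeating every reduction\<close>

lemma omega_jump_refl: "omega_jump n x x"
  by (cases n) (simp_all add: halting_jump_def)

lemma diag_ceer_not_reducible: "\<not> diag_ceer (Suc n) \<le>\<^sub>c omega_jump n"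
proof
  assume "diag_ceer (Suc n) \<le>\<^sub>c omega_jump n"
  then obtain f e where f: "\<And>x. phi e x = Some (f x)"
    and red: "\<And>x y. diag_ceer (Suc n) x y \<longleftrightarrow> omega_jump n (f x) (f y)"
    unfolding reducible_def total_computable_def by blast
  define N :: nat where "N = 2 ^ Suc n"
  \<comment> \<open>The diagonal choice: the column carries the index of the reduction
    itself.\<close>
  define E where "E x y = diag_ceer (Suc n) (pair e x) (pair e y)" for x y
  have E: "E x y \<longleftrightarrow> x = y \<or>
      (\<exists>j\<le>Suc n. x div 2 ^ j = y div 2 ^ j \<and> (\<forall>i<j. separated (Suc n) i e))"
    if "x < N" "y < N" for x y
    using that unfolding E_def diag_ceer_def N_def by auto
  \<comment> \<open>The invariant: after \<open>j\<close> rounds the iterated values still reduce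
    the column to a jump of the identity, now \<open>n - j\<close> times iterated.\<close>
  define V where "V j val \<longleftrightarrow> (\<forall>x<N. iterate_val j (pair e x) = Some (val x)) \<and>
      (\<forall>x<N. \<forall>y<N. E x y \<longleftrightarrow> omega_jump (n - j) (val x) (val y))" for j val
  have sep: "separated (Suc n) j e \<and> (\<forall>x<N. \<forall>y<N. x div 2 ^ j \<noteq> y div 2 ^ j \<longrightarrow> val x \<noteq> val y)"
    if "V j val" for j val
  proof -
    have "val x \<noteq> val y" if xy: "x < N" "y < N" "x div 2 ^ j \<noteq> y div 2 ^ j" for x y
    proof
      \<comment> \<open>Equal values are related, so \<open>E\<close> must have merged the two
        blocks. That takes a round beyond \<open>j\<close>, hence separation at level
        \<open>j\<close>, which the equality contradicts.\<close>
      assume eq: "val x = val y"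
      then have "E x y" using xy \<open>V j val\<close> omega_jump_refl unfolding V_def by metis
      moreover have "x \<noteq> y" using xy by auto
      ultimately obtain j' where j': "x div 2 ^ j' = y div 2 ^ j'" "\<forall>i<j'. separated (Suc n) i e"
        using E xy by blast
      then have "j < j'" using xy(3) div_power2_mono[of x j' y j] by (meson not_le)
      then have "separated (Suc n) j e" using j' by blast
      then show False
        using xy eq \<open>V j val\<close> unfolding separated_def V_def N_def by fastforce
    qed
    then show ?thesis using that unfolding separated_def V_def N_def by auto
  qed
  have inv: "j \<le> n \<Longrightarrow> (\<forall>i<j. separated (Suc n) i e) \<and> (\<exists>val. V j val)" for j
  proof (induction j)
    case 0
    have "V 0 (\<lambda>x. f (pair e x))" unfolding V_def E_def by (simp add: f red)
    then show ?case by blast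
  next
    case (Suc j)
    then obtain val where V: "V j val" and less: "\<forall>i<j. separated (Suc n) i e" by auto
    have diff: "val x \<noteq> val y" if "x < N" "y < N" "x div 2 ^ j \<noteq> y div 2 ^ j" for x y
      using sep[OF V] that by blast
    have seps: "\<forall>i<Suc j. separated (Suc n) i e" using less sep[OF V] by (simp add: less_Suc_eq)
    have jump: "omega_jump (n - j) = halting_jump (omega_jump (n - Suc j))"
      using Suc.prems by (simp add: Suc_diff_Suc[symmetric])
    have EV: "E x y \<longleftrightarrow> halting_jump (omega_jump (n - Suc j)) (val x) (val y)"
      if "x < N" "y < N" for x y
      using V that unfolding V_def jump by blast
    \<comment> \<open>The sibling \<open>y\<close> is now \<open>E\<close>-related to
      \<open>x\<close> although their values differ, so the jump relates them through convergent
      diagonal computations.\<close>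
    have "\<exists>a. phi (val x) (val x) = Some a" if x: "x < N" for x
    proof -
      obtain y where y: "y < N" "y div 2 ^ Suc j = x div 2 ^ Suc j" "y div 2 ^ j \<noteq> x div 2 ^ j"
        using ex_sibling_block[of x "Suc n" j] x Suc.prems unfolding N_def by auto
      then have "E x y" unfolding E[OF x y(1)] using seps Suc.prems by (metis Suc_leD Suc_le_mono)
      then show ?thesis using EV[OF x y(1)] diff[OF x y(1)] y(3) unfolding halting_jump_def by metis
    qed
    then obtain val' where val': "\<And>x. x < N \<Longrightarrow> phi (val x) (val x) = Some (val' x)" by metis
    have "V (Suc j) val'"
      unfolding V_def
    proof (intro conjI allI impI)
      show "iterate_val (Suc j) (pair e x) = Some (val' x)" if "x < N" for x
        using V val' that unfolding V_def by simp
      \<comment> \<open>If \<open>val x = val y\<close>, the new values agree too and reflexivity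
        applies; otherwise the second clause of the jump does.\<close>
      show "E x y \<longleftrightarrow> omega_jump (n - Suc j) (val' x) (val' y)" if "x < N" "y < N" for x y
        using EV[OF that] val'[OF that(1)] val'[OF that(2)] omega_jump_refl
        unfolding halting_jump_def by auto
    qed
    with seps show ?case by blast
  qed
  from inv[of n] obtain val where V: "V n val" and less: "\<forall>i<n. separated (Suc n) i e" by auto
  \<comment> \<open>After \<open>n\<close> rounds two blocks remain, represented by 0 and
    \<open>2 ^ n\<close>. Separation at level \<open>n\<close> permits their merging, yet level
    \<open>n\<close> of the values lives in the identity relation.\<close>
  have N: "0 < N" "2 ^ n < N" by (simp_all add: N_def)
  have "\<forall>i<Suc n. separated (Suc n) i e" using less sep[OF V] by (simp add: less_Suc_eq)
  then have "E 0 (2 ^ n)" unfolding E[OF N] by (intro disjI2 exI[of _ "Suc n"]) simp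
  then have "val 0 = val (2 ^ n)" using V N unfolding V_def by simp
  then show False using sep[OF V] N by force
qed

theorem theorem8p9:
  fixes n :: nat
  shows "\<not> bounded_ceer_inf (2 ^ (n + 1)) \<le>\<^sub>c omega_jump n"
proof
  assume "bounded_ceer_inf (2 ^ (n + 1)) \<le>\<^sub>c omega_jump n"
  then obtain f where f: "total_computable f"
    "\<And>u v. bounded_ceer_inf (2 ^ (n + 1)) u v \<longleftrightarrow> omega_jump n (f u) (f v)"
    unfolding reducible_def by blast
  \<comment> \<open>By completeness of the enumeration, the diagonal ceer is column \<open>e\<close>
    of \<open>bounded_ceer_inf\<close>, where the column number is the second component.\<close>
  obtain e where e: "bounded_ceer (2 ^ (n + 1)) e = diag_ceer (Suc n)"
    using bounded_ceer_complete[OF ceer_diag_ceer[of "Suc n"] k_bounded_diag_ceer] by auto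
  have "total_computable (\<lambda>x. f (pair x e))"
    by (rule total_computable_comp[OF f(1)]) (intro computable)
  moreover have "diag_ceer (Suc n) x y \<longleftrightarrow> omega_jump n (f (pair x e)) (f (pair y e))" for x y
    unfolding f(2)[symmetric] bounded_ceer_inf_def e[symmetric] by simp
  ultimately have "diag_ceer (Suc n) \<le>\<^sub>c omega_jump n"
    unfolding reducible_def by (intro exI[of _ "\<lambda>x. f (pair x e)"]) blast
  then show False using diag_ceer_not_reducible by blast
qed

end
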